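(* Let $n\ge 2$, let $N=\{1,\dots,n\}$, and let $\alpha,\beta$ be nonempty index sets with $\alpha\cup\beta=N$ and $\alpha\cap\beta=\emptyset$. Let $A=[a_{ij}]\in\mathbb{C}^{n\times n}$ and let $\lambda$ be an eigenvalue of $A$. Then $$\lambda\in E^{(\alpha\beta)}(A):=\left(\bigcup_{i\in\alpha}G_i^{(\alpha)}(A)\right)\cup\left(\bigcup_{j\in\beta}G_j^{(\beta)}(A)\right)\cup\left(\bigcup_{i\in\alpha,\,j\in\beta}\left(G_{ij}^{(\alpha\beta)}(A)\setminus\widetilde{E}_{ij}^{(\alpha\beta)}(A)\right)\right)\cup\left(\bigcup_{i\in\alpha,\,j\in\beta}\left(G_{ij}^{(\alpha\beta)}(A)\setminus\widehat{E}_{ij}^{(\alpha\beta)}(A)\right)\right),$$ where, for $i\in\alpha$ and $j\in\beta$, $$\widetilde{E}_{ij}^{(\alpha\beta)}(A)=\left\{z\in\mathbb{C}:\left(|z-a_{ii}|+r_i^j(A)\right)\left(|z-a_{jj}|+r_j^\beta(A)\right)<|a_{ij}|\left(2|a_{ji}|-r_j^\alpha(A)\right)\right\},$$ $$\widehat{E}_{ij}^{(\alpha\beta)}(A)=\left\{z\in\mathbb{C}:\left(|z-a_{jj}|+r_j^i(A)\right)\left(|z-a_{ii}|+r_i^\alpha(A)\right)<|a_{ji}|\left(2|a_{ij}|-r_i^\beta(A)\right)\right\}.$$ Furthermore, $E^{(\alpha\beta)}(A)\subseteq G^{(\alpha\beta)}(A)$.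
   Context: For $A=[a_{ij}]\in\mathbb{C}^{n\times n}$ and $i\in N=\{1,\dots,n\}$, the partial absolute deleted row sums are $$r_i^\alpha(A)=\sum_{k\in\alpha,\ k\ne i}|a_{ik}|,\qquad r_i^\beta(A)=\sum_{k\in\beta,\ k\ne i}|a_{ik}|,$$ with empty sums equal to $0$ (so $r_{i_0}^\alpha(A)=0$ if $\alpha=\{i_0\}$, and $r_{i_0}^\beta(A)=0$ if $\beta=\{i_0\}$). For $i\ne j$ in $N$, $$r_i^j(A)=\sum_{k\in N,\ k\ne i,j}|a_{ik}|.$$ For $i\in\alpha$ and $j\in\beta$ define $$G_i^{(\alpha)}(A)=\{z\in\mathbb{C}:|a_{ii}-z|\le r_i^\alpha(A)\},\qquad G_j^{(\beta)}(A)=\{z\in\mathbb{C}:|a_{jj}-z|\le r_j^\beta(A)\},$$ $$G_{ij}^{(\alpha\beta)}(A)=\left\{z\in\mathbb{C}: z\notin G_i^{(\alpha)}(A)\cup G_j^{(\beta)}(A),\ \left(|a_{ii}-z|-r_i^\alpha(A)\right)\left(|a_{jj}-z|-r_j^\beta(A)\right)\le r_i^\beta(A)\,r_j^\alpha(A)\right\},$$ and $$G^{(\alpha\beta)}(A)=\left(\bigcup_{i\in\alpha}G_i^{(\alpha)}(A)\right)\cup\left(\bigcup_{j\in\beta}G_j^{(\beta)}(A)\right)\cup\left(\bigcup_{i\in\alpha,\,j\in\beta}G_{ij}^{(\alpha\beta)}(A)\right).$$ *)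

theory Defs
  imports Complex_Main "Jordan_Normal_Form.Char_Poly"
begin

text \<open>Rows and columns of matrices are indexed from \<open>0\<close>, so that the index set
  \<open>{1, \<dots>, n}\<close> becomes \<open>{0..<n}\<close>.\<close>

definition partial_row_sum :: "complex mat \<Rightarrow> nat set \<Rightarrow> nat \<Rightarrow> real" where
  "partial_row_sum A \<alpha> i = (\<Sum>k\<in>\<alpha> - {i}. cmod (A $$ (i, k)))"

text \<open>The quantity usually written \<open>r_i^j(A)\<close> is \<open>deleted_row_sum A i j\<close>: row \<open>i\<close>, with both
  columns \<open>i\<close> and \<open>j\<close> left out.\<close>

definition deleted_row_sum :: "complex mat \<Rightarrow> nat \<Rightarrow> nat \<Rightarrow> real" where
  "deleted_row_sum A i j = (\<Sum>k\<in>{0..<dim_col A} - {i, j}. cmod (A $$ (i, k)))"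

text \<open>\<open>G_disc A \<alpha> i\<close> is used for \<open>i \<in> \<alpha>\<close>, and \<open>G_disc A \<beta> j\<close> for \<open>j \<in> \<beta>\<close>.\<close>

definition G_disc :: "complex mat \<Rightarrow> nat set \<Rightarrow> nat \<Rightarrow> complex set" where
  "G_disc A \<alpha> i = {z. cmod (A $$ (i, i) - z) \<le> partial_row_sum A \<alpha> i}"

definition G_pair :: "complex mat \<Rightarrow> nat set \<Rightarrow> nat set \<Rightarrow> nat \<Rightarrow> nat \<Rightarrow> complex set" where
  "G_pair A \<alpha> \<beta> i j =
    {z. z \<notin> G_disc A \<alpha> i \<union> G_disc A \<beta> j \<and>
        (cmod (A $$ (i, i) - z) - partial_row_sum A \<alpha> i) *
        (cmod (A $$ (j, j) - z) - partial_row_sum A \<beta> j)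
        \<le> partial_row_sum A \<beta> i * partial_row_sum A \<alpha> j}"

definition G_set :: "complex mat \<Rightarrow> nat set \<Rightarrow> nat set \<Rightarrow> complex set" where
  "G_set A \<alpha> \<beta> =
    (\<Union>i\<in>\<alpha>. G_disc A \<alpha> i) \<union> (\<Union>j\<in>\<beta>. G_disc A \<beta> j) \<union>
    (\<Union>i\<in>\<alpha>. \<Union>j\<in>\<beta>. G_pair A \<alpha> \<beta> i j)"

definition E_tilde :: "complex mat \<Rightarrow> nat set \<Rightarrow> nat set \<Rightarrow> nat \<Rightarrow> nat \<Rightarrow> complex set" where
  "E_tilde A \<alpha> \<beta> i j =
    {z. (cmod (z - A $$ (i, i)) + deleted_row_sum A i j) *
        (cmod (z - A $$ (j, j)) + partial_row_sum A \<beta> j)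
        < cmod (A $$ (i, j)) * (2 * cmod (A $$ (j, i)) - partial_row_sum A \<alpha> j)}"

definition E_hat :: "complex mat \<Rightarrow> nat set \<Rightarrow> nat set \<Rightarrow> nat \<Rightarrow> nat \<Rightarrow> complex set" where
  "E_hat A \<alpha> \<beta> i j =
    {z. (cmod (z - A $$ (j, j)) + deleted_row_sum A j i) *
        (cmod (z - A $$ (i, i)) + partial_row_sum A \<alpha> i)
        < cmod (A $$ (j, i)) * (2 * cmod (A $$ (i, j)) - partial_row_sum A \<beta> i)}"

definition E_set :: "complex mat \<Rightarrow> nat set \<Rightarrow> nat set \<Rightarrow> complex set" where
  "E_set A \<alpha> \<beta> =
    (\<Union>i\<in>\<alpha>. G_disc A \<alpha> i) \<union> (\<Union>j\<in>\<beta>. G_disc A \<beta> j) \<union>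
    (\<Union>i\<in>\<alpha>. \<Union>j\<in>\<beta>. G_pair A \<alpha> \<beta> i j - E_tilde A \<alpha> \<beta> i j) \<union>
    (\<Union>i\<in>\<alpha>. \<Union>j\<in>\<beta>. G_pair A \<alpha> \<beta> i j - E_hat A \<alpha> \<beta> i j)"

end

theory Submission
  imports Defs
begin

text \<open>Take an eigenvector \<open>x\<close> for \<open>l\<close> and let \<open>p \<in> \<alpha>\<close> and \<open>q \<in> \<beta>\<close> be indices at which \<open>\<bar>x\<bar>\<close> is
  maximal on \<open>\<alpha>\<close> and on \<open>\<beta>\<close>. Suppose that \<open>l\<close> lies in none of the discs. Rows \<open>p\<close> and \<open>q\<close> of the
  eigenvector equation then say
    \<open>(\<bar>a\<^sub>p\<^sub>p - l\<bar> - r\<^sub>p\<^sup>\<alpha>) \<bar>x\<^sub>p\<bar> \<le> r\<^sub>p\<^sup>\<beta> \<bar>x\<^sub>q\<bar>\<close> and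
    \<open>(\<bar>a\<^sub>q\<^sub>q - l\<bar> - r\<^sub>q\<^sup>\<beta>) \<bar>x\<^sub>q\<bar> \<le> r\<^sub>q\<^sup>\<alpha> \<bar>x\<^sub>p\<bar>\<close>
  with positive factors on the left. So neither \<open>x\<^sub>p\<close> nor \<open>x\<^sub>q\<close> can vanish, and multiplying the two
  inequalities puts \<open>l\<close> into the pair region of \<open>p\<close> and \<open>q\<close>.

  The excluded regions come from solving the same two rows for an off-diagonal term instead of the
  diagonal one. If \<open>\<bar>x\<^sub>q\<bar> \<le> \<bar>x\<^sub>p\<bar>\<close>, then \<open>\<bar>x\<^sub>p\<bar>\<close> is the largest entry overall, and isolating
  \<open>a\<^sub>p\<^sub>q x\<^sub>q\<close> in row \<open>p\<close> gives
    \<open>\<bar>a\<^sub>p\<^sub>q\<bar> \<bar>x\<^sub>q\<bar> \<le> (\<bar>l - a\<^sub>p\<^sub>p\<bar> + r\<^sub>p\<^sup>q) \<bar>x\<^sub>p\<bar>\<close>,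
  while isolating \<open>a\<^sub>q\<^sub>p x\<^sub>p\<close> in row \<open>q\<close> gives
    \<open>(2 \<bar>a\<^sub>q\<^sub>p\<bar> - r\<^sub>q\<^sup>\<alpha>) \<bar>x\<^sub>p\<bar> \<le> (\<bar>l - a\<^sub>q\<^sub>q\<bar> + r\<^sub>q\<^sup>\<beta>) \<bar>x\<^sub>q\<bar>\<close>.
  Their product is the negation of the inequality that defines the first excluded region. If
  \<open>\<bar>x\<^sub>p\<bar> \<le> \<bar>x\<^sub>q\<bar>\<close>, exchanging the roles of \<open>\<alpha>\<close> and \<open>\<beta>\<close> rules out the second one. The two cases
  involve the same pair \<open>p\<close>, \<open>q\<close>, so \<open>l\<close> survives in one of the two unions.\<close>

lemma norm_weighted_sum_le:
  fixes a x :: "'i \<Rightarrow> complex"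
  assumes "\<And>k. k \<in> S \<Longrightarrow> cmod (x k) \<le> M"
  shows "cmod (\<Sum>k\<in>S. a k * x k) \<le> (\<Sum>k\<in>S. cmod (a k)) * M"
proof -
  have "cmod (\<Sum>k\<in>S. a k * x k) \<le> (\<Sum>k\<in>S. cmod (a k) * M)"
    by (rule sum_norm_le) (auto simp: norm_mult assms intro: mult_left_mono)
  then show ?thesis by (simp add: sum_distrib_right)
qed

lemma partial_row_sum_nonneg: "0 \<le> partial_row_sum A \<gamma> i"
  unfolding partial_row_sum_def by (rule sum_nonneg) simp

lemma deleted_row_sum_nonneg: "0 \<le> deleted_row_sum A i j"
  unfolding deleted_row_sum_def by (rule sum_nonneg) simp

lemma E_hat_eq_E_tilde_swap: "E_hat A \<alpha> \<beta> i j = E_tilde A \<beta> \<alpha> j i"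
  unfolding E_hat_def E_tilde_def by simp

text \<open>The assumptions are invariant under exchanging \<open>(\<alpha>, p)\<close> with \<open>(\<beta>, q)\<close>. So it is enough to
  analyse row \<open>p\<close>: interpreting the locale with the roles exchanged gives the mirror image of each
  estimate for row \<open>q\<close>.\<close>

locale block_maximal_eigenvector =
  fixes A :: "complex mat" and n :: nat and \<alpha> \<beta> :: "nat set" and l :: complex
    and x :: "nat \<Rightarrow> complex" and p q :: nat
  assumes carrier: "A \<in> carrier_mat n n"
    and cover: "\<alpha> \<union> \<beta> = {0..<n}" and disjoint: "\<alpha> \<inter> \<beta> = {}"
    and row: "i < n \<Longrightarrow> (\<Sum>k\<in>{0..<n}. A $$ (i, k) * x k) = l * x i"
    and p: "p \<in> \<alpha>" and q: "q \<in> \<beta>"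
    and le_p: "k \<in> \<alpha> \<Longrightarrow> cmod (x k) \<le> cmod (x p)"
    and le_q: "k \<in> \<beta> \<Longrightarrow> cmod (x k) \<le> cmod (x q)"
begin

lemma swapped: "block_maximal_eigenvector A n \<beta> \<alpha> l x q p"
  using carrier cover disjoint row p q le_p le_q
  by unfold_locales auto

lemma finite_blocks: "finite \<alpha>" "finite \<beta>"
  using cover finite_Un by (metis finite_atLeastLessThan)+

lemma p_q_facts: "p < n" "q < n" "p \<noteq> q" "p \<notin> \<beta>" "q \<notin> \<alpha>"
  using cover disjoint p q by auto

lemma row_p_split:
  "(l - A $$ (p, p)) * x p =
    (\<Sum>k\<in>\<alpha> - {p}. A $$ (p, k) * x k) + (\<Sum>k\<in>\<beta> - {p}. A $$ (p, k) * x k)"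
proof -
  let ?f = "\<lambda>k. A $$ (p, k) * x k"
  have "l * x p = sum ?f (\<alpha> \<union> \<beta>)"
    using row[OF p_q_facts(1)] cover by simp
  also have "\<dots> = sum ?f \<alpha> + sum ?f \<beta>"
    by (rule sum.union_disjoint) (use finite_blocks disjoint in auto)
  also have "sum ?f \<alpha> = ?f p + sum ?f (\<alpha> - {p})"
    by (rule sum.remove) (use finite_blocks p in auto)
  finally show ?thesis
    using p_q_facts(4) by (simp add: algebra_simps)
qed

lemma row_p_diagonal_bound:
  "(cmod (A $$ (p, p) - l) - partial_row_sum A \<alpha> p) * cmod (x p)
    \<le> partial_row_sum A \<beta> p * cmod (x q)"
proof -
  have "cmod (A $$ (p, p) - l) * cmod (x p) = cmod ((l - A $$ (p, p)) * x p)"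
    by (simp add: norm_mult norm_minus_commute)
  also have "\<dots> \<le> cmod (\<Sum>k\<in>\<alpha> - {p}. A $$ (p, k) * x k)
                + cmod (\<Sum>k\<in>\<beta> - {p}. A $$ (p, k) * x k)"
    unfolding row_p_split by (rule norm_triangle_ineq)
  also have "\<dots> \<le> partial_row_sum A \<alpha> p * cmod (x p) + partial_row_sum A \<beta> p * cmod (x q)"
    unfolding partial_row_sum_def
    by (intro add_mono norm_weighted_sum_le) (auto intro: le_p le_q)
  finally show ?thesis by (simp add: algebra_simps)
qed

text \<open>Isolating \<open>a\<^sub>p\<^sub>q x\<^sub>q\<close> leaves the rest of the \<open>\<beta>\<close>-part of the row, of weight
  \<open>r\<^sub>p\<^sup>\<beta> - \<bar>a\<^sub>p\<^sub>q\<bar>\<close>, on the other side. Bounding that by \<open>\<bar>x\<^sub>q\<bar>\<close> too and moving it back accounts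
  for the factor \<open>2\<close>.\<close>

lemma row_p_coupling_bound:
  "(2 * cmod (A $$ (p, q)) - partial_row_sum A \<beta> p) * cmod (x q)
    \<le> (cmod (l - A $$ (p, p)) + partial_row_sum A \<alpha> p) * cmod (x p)"
proof -
  let ?f = "\<lambda>k. A $$ (p, k) * x k"
  have q_mem: "q \<in> \<beta> - {p}" and fin: "finite (\<beta> - {p})"
    using q p_q_facts finite_blocks by auto
  have f_q: "?f q = (l - A $$ (p, p)) * x p - (sum ?f (\<alpha> - {p}) + sum ?f (\<beta> - {p} - {q}))"
    unfolding row_p_split sum.remove[OF fin q_mem] by simp
  have rest: "(\<Sum>k\<in>\<beta> - {p} - {q}. cmod (A $$ (p, k)))
      = partial_row_sum A \<beta> p - cmod (A $$ (p, q))"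
    unfolding partial_row_sum_def sum.remove[OF fin q_mem] by simp
  have "cmod (A $$ (p, q)) * cmod (x q) = cmod (?f q)"
    by (simp add: norm_mult)
  also have "\<dots> \<le> cmod ((l - A $$ (p, p)) * x p)
      + (cmod (sum ?f (\<alpha> - {p})) + cmod (sum ?f (\<beta> - {p} - {q})))"
    unfolding f_q by (intro order_trans[OF norm_triangle_ineq4] add_mono norm_triangle_ineq order_refl)
  also have "\<dots> \<le> cmod (l - A $$ (p, p)) * cmod (x p)
      + (partial_row_sum A \<alpha> p * cmod (x p)
         + (\<Sum>k\<in>\<beta> - {p} - {q}. cmod (A $$ (p, k))) * cmod (x q))"
    unfolding partial_row_sum_def
    by (intro add_mono norm_weighted_sum_le) (auto simp: norm_mult intro: le_p le_q)
  finally show ?thesis unfolding rest by (simp add: algebra_simps)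
qed

lemma row_p_coupling_bound_of_global_max:
  assumes "cmod (x q) \<le> cmod (x p)"
  shows "cmod (A $$ (p, q)) * cmod (x q)
    \<le> (cmod (l - A $$ (p, p)) + deleted_row_sum A p q) * cmod (x p)"
proof -
  let ?f = "\<lambda>k. A $$ (p, k) * x k"
  let ?R = "{0..<n} - {p, q}"
  \<comment> \<open>The deleted row sum mixes columns of both blocks, so a bound valid on both is needed.\<close>
  have p_max: "cmod (x k) \<le> cmod (x p)" if "k \<in> ?R" for k
    using that cover le_p le_q assms by (metis DiffD1 UnE order_trans)
  have "l * x p = ?f p + (?f q + sum ?f ?R)"
    using row[OF p_q_facts(1)] p_q_facts(1-3)
    by (simp add: sum.remove[of _ p] sum.remove[of _ q] Diff_insert2[symmetric]
        insert_commute)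
  then have f_q: "?f q = (l - A $$ (p, p)) * x p - sum ?f ?R"
    by (simp add: algebra_simps)
  have "cmod (A $$ (p, q)) * cmod (x q) = cmod (?f q)"
    by (simp add: norm_mult)
  also have "\<dots> \<le> cmod ((l - A $$ (p, p)) * x p) + cmod (sum ?f ?R)"
    unfolding f_q by (rule norm_triangle_ineq4)
  also have "\<dots> \<le> cmod (l - A $$ (p, p)) * cmod (x p)
      + (\<Sum>k\<in>?R. cmod (A $$ (p, k))) * cmod (x p)"
    by (intro add_mono norm_weighted_sum_le p_max) (simp_all add: norm_mult)
  finally show ?thesis
    using carrier by (simp add: deleted_row_sum_def algebra_simps)
qed

text \<open>The product of the two coupling bounds is the negated defining inequality, times the positive
  factor \<open>\<bar>x\<^sub>p\<bar> \<bar>x\<^sub>q\<bar>\<close>. The bounds may be multiplied only if \<open>2 \<bar>a\<^sub>q\<^sub>p\<bar> - r\<^sub>q\<^sup>\<alpha>\<close> is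
  nonnegative; if it is negative, the region is empty.\<close>

lemma not_in_E_tilde:
  assumes "cmod (x q) \<le> cmod (x p)" and "x p \<noteq> 0" and "x q \<noteq> 0"
  shows "l \<notin> E_tilde A \<alpha> \<beta> p q"
proof -
  interpret swap: block_maximal_eigenvector A n \<beta> \<alpha> l x q p
    by (rule swapped)
  let ?c = "cmod (A $$ (p, q))"
  let ?d = "2 * cmod (A $$ (q, p)) - partial_row_sum A \<alpha> q"
  let ?P = "cmod (l - A $$ (p, p)) + deleted_row_sum A p q"
  let ?Q = "cmod (l - A $$ (q, q)) + partial_row_sum A \<beta> q"
  have nonneg: "0 \<le> ?P" "0 \<le> ?Q"
    by (simp_all add: deleted_row_sum_nonneg partial_row_sum_nonneg)
  have "?c * ?d \<le> ?P * ?Q"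
  proof (cases "0 \<le> ?d")
    case True
    have "(?c * cmod (x q)) * (?d * cmod (x p)) \<le> (?P * cmod (x p)) * (?Q * cmod (x q))"
      by (rule mult_mono[OF row_p_coupling_bound_of_global_max[OF assms(1)]
            swap.row_p_coupling_bound])
        (use True nonneg in auto)
    then have "(?c * ?d) * (cmod (x p) * cmod (x q)) \<le> (?P * ?Q) * (cmod (x p) * cmod (x q))"
      by (simp add: mult_ac)
    then show ?thesis
      using assms(2,3) by (simp add: mult_le_cancel_right)
  next
    case False
    then have "?c * ?d \<le> 0" by (simp add: mult_nonneg_nonpos)
    also have "0 \<le> ?P * ?Q" using nonneg by simp
    finally show ?thesis .
  qed
  then show ?thesis by (simp add: E_tilde_def)
qed

text \<open>Outside the disc of row \<open>p\<close>, the coupling to the \<open>\<beta>\<close>-block is all that keeps \<open>x\<^sub>p\<close> away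
  from \<open>0\<close>: if \<open>x\<close> vanished on \<open>\<beta>\<close>, it would vanish on \<open>\<alpha>\<close> as well.\<close>

lemma maximal_entry_nonzero:
  assumes "x i \<noteq> 0" and "i < n" and "l \<notin> G_disc A \<alpha> p"
  shows "x q \<noteq> 0"
proof
  assume "x q = 0"
  then have "(cmod (A $$ (p, p) - l) - partial_row_sum A \<alpha> p) * cmod (x p) \<le> 0"
    using row_p_diagonal_bound by simp
  then have "x p = 0"
    using assms(3) by (simp add: G_disc_def mult_le_0_iff)
  moreover have "i \<in> \<alpha> \<or> i \<in> \<beta>" using assms(2) cover by auto
  ultimately show False
    using \<open>x q = 0\<close> assms(1) le_p[of i] le_q[of i] by auto
qed

lemma in_G_pair:
  assumes "x p \<noteq> 0" and "x q \<noteq> 0"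
    and "l \<notin> G_disc A \<alpha> p" and "l \<notin> G_disc A \<beta> q"
  shows "l \<in> G_pair A \<alpha> \<beta> p q"
proof -
  interpret swap: block_maximal_eigenvector A n \<beta> \<alpha> l x q p
    by (rule swapped)
  let ?g = "cmod (A $$ (p, p) - l) - partial_row_sum A \<alpha> p"
  let ?h = "cmod (A $$ (q, q) - l) - partial_row_sum A \<beta> q"
  have "(?g * cmod (x p)) * (?h * cmod (x q))
      \<le> (partial_row_sum A \<beta> p * cmod (x q)) * (partial_row_sum A \<alpha> q * cmod (x p))"
    by (rule mult_mono[OF row_p_diagonal_bound swap.row_p_diagonal_bound])
      (use assms(3,4) in \<open>auto simp: G_disc_def partial_row_sum_nonneg\<close>)
  then have "(?g * ?h) * (cmod (x p) * cmod (x q))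
      \<le> (partial_row_sum A \<beta> p * partial_row_sum A \<alpha> q) * (cmod (x p) * cmod (x q))"
    by (simp add: mult_ac)
  then show ?thesis
    using assms by (simp add: G_pair_def mult_le_cancel_right)
qed

lemma in_E_set:
  assumes "x i \<noteq> 0" and "i < n"
  shows "l \<in> E_set A \<alpha> \<beta>"
proof (cases "l \<in> G_disc A \<alpha> p \<or> l \<in> G_disc A \<beta> q")
  case True
  then show ?thesis using p q by (auto simp: E_set_def)
next
  case False
  interpret swap: block_maximal_eigenvector A n \<beta> \<alpha> l x q p
    by (rule swapped)
  have nonzero: "x p \<noteq> 0" "x q \<noteq> 0"
    using False assms maximal_entry_nonzero swap.maximal_entry_nonzero by auto
  have "l \<in> G_pair A \<alpha> \<beta> p q"
    using in_G_pair nonzero False by auto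
  moreover have "l \<notin> E_tilde A \<alpha> \<beta> p q \<or> l \<notin> E_hat A \<alpha> \<beta> p q"
    unfolding E_hat_eq_E_tilde_swap
    using not_in_E_tilde swap.not_in_E_tilde nonzero by (meson linear)
  ultimately show ?thesis
    using p q by (auto simp: E_set_def)
qed

end

lemma eigenvalue_row_equations:
  fixes A :: "complex mat"
  assumes "A \<in> carrier_mat n n" and "eigenvalue A l"
  obtains x i where "i < n" "x i \<noteq> 0"
    and "\<And>i. i < n \<Longrightarrow> (\<Sum>k\<in>{0..<n}. A $$ (i, k) * x k) = l * x i"
proof -
  obtain v where v: "v \<in> carrier_vec n" "v \<noteq> 0\<^sub>v n" "A *\<^sub>v v = l \<cdot>\<^sub>v v"
    using assms unfolding eigenvalue_def eigenvector_def by auto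
  have "\<exists>i<n. v $ i \<noteq> 0"
    using v(1,2) by auto
  then obtain i where "i < n" "v $ i \<noteq> 0" by blast
  moreover have "(\<Sum>k\<in>{0..<n}. A $$ (j, k) * v $ k) = l * v $ j" if "j < n" for j
  proof -
    have "(A *\<^sub>v v) $ j = (\<Sum>k\<in>{0..<n}. A $$ (j, k) * v $ k)"
      using assms(1) v(1) that by (auto simp: scalar_prod_def intro!: sum.cong)
    then show ?thesis using v(1,3) that by simp
  qed
  ultimately show thesis using that[of i "\<lambda>k. v $ k"] by blast
qed

lemma E_set_subset_G_set: "E_set A \<alpha> \<beta> \<subseteq> G_set A \<alpha> \<beta>"
  unfolding E_set_def G_set_def by blast

theorem theorem2:
  fixes n :: nat and \<alpha> \<beta> :: "nat set" and A :: "complex mat" and l :: complex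
  assumes "n \<ge> 2"
    and "\<alpha> \<noteq> {}" and "\<beta> \<noteq> {}"
    and "\<alpha> \<union> \<beta> = {0..<n}" and "\<alpha> \<inter> \<beta> = {}"
    and "A \<in> carrier_mat n n"
    and "eigenvalue A l"
  shows "l \<in> E_set A \<alpha> \<beta> \<and> E_set A \<alpha> \<beta> \<subseteq> G_set A \<alpha> \<beta>"
proof -
  obtain x i where x: "i < n" "x i \<noteq> 0"
      and row: "\<And>i. i < n \<Longrightarrow> (\<Sum>k\<in>{0..<n}. A $$ (i, k) * x k) = l * x i"
    using eigenvalue_row_equations[OF assms(6,7)] by blast
  have fin: "finite \<alpha>" "finite \<beta>"
    using assms(4) finite_Un by (metis finite_atLeastLessThan)+
  have argmax: "\<exists>m\<in>S. \<forall>k\<in>S. cmod (x k) \<le> cmod (x m)" if "finite S" "S \<noteq> {}" for S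
    using Max_in[of "(\<lambda>k. cmod (x k)) ` S"] Max_ge[of "(\<lambda>k. cmod (x k)) ` S"] that by fastforce
  obtain p where p: "p \<in> \<alpha>" "\<And>k. k \<in> \<alpha> \<Longrightarrow> cmod (x k) \<le> cmod (x p)"
    using argmax[OF fin(1) assms(2)] by blast
  obtain q where q: "q \<in> \<beta>" "\<And>k. k \<in> \<beta> \<Longrightarrow> cmod (x k) \<le> cmod (x q)"
    using argmax[OF fin(2) assms(3)] by blast
  interpret block_maximal_eigenvector A n \<alpha> \<beta> l x p q
    using assms(4-6) row p q by unfold_locales auto
  show ?thesis
    using in_E_set[OF x(2,1)] E_set_subset_G_set by blast
qed

end
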